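(* For all positive integers $n$, $m$ and $s$, $$N(\mathrm{Sp}(n),m,s)=\binom{n-1}{s-1}\binom{[m/2]+1}{s}.$$
   Context: $\mathrm{Sp}(n)=\mathrm{Sp}(2n,\mathbb{C})\cap U(2n)$ is the compact symplectic group. Every element of $\mathrm{Sp}(n)$ is conjugate in $\mathrm{Sp}(n)$ to a diagonal matrix $\mathrm{diag}(e^{2\pi i\theta_1},\dots,e^{2\pi i\theta_n},e^{-2\pi i\theta_1},\dots,e^{-2\pi i\theta_n})$ with all $\theta_l\in[0,1/2]$; the number of distinct conjugate pairs of eigenvalues of the element is the number of distinct values among $\theta_1,\dots,\theta_n$. $N(\mathrm{Sp}(n),m,s)$ denotes the number of conjugacy classes of $\mathrm{Sp}(n)$ consisting of elements $x$ with $x^m=1$ having exactly $s$ distinct conjugate pairs of eigenvalues. $[\cdot]$ denotes the integer part (floor). *)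

theory Defs
  imports "HOL-Algebra.Group_Action" "Jordan_Normal_Form.Spectral_Radius"
begin

definition symplectic_form_mat :: "nat \<Rightarrow> complex mat" where
  "symplectic_form_mat n =
     four_block_mat (0\<^sub>m n n) (1\<^sub>m n) (- 1\<^sub>m n) (0\<^sub>m n n)"

definition Sp_complex :: "nat \<Rightarrow> complex mat set" where
  "Sp_complex n = {A \<in> carrier_mat (2 * n) (2 * n).
     transpose_mat A * symplectic_form_mat n * A = symplectic_form_mat n}"

definition unitary_mats :: "nat \<Rightarrow> complex mat set" where
  "unitary_mats d = {A \<in> carrier_mat d d. mat_adjoint A * A = 1\<^sub>m d}"

definition compact_Sp :: "nat \<Rightarrow> complex mat monoid" where
  "compact_Sp n = \<lparr>carrier = Sp_complex n \<inter> unitary_mats (2 * n), monoid.mult = (*), one = 1\<^sub>m (2 * n)\<rparr>"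

text \<open>Conjugacy classes are the orbits of the conjugation action, in the form used
  in \<open>group.action_by_conjugation\<close>.\<close>

definition conjugacy_classes :: "('a, 'b) monoid_scheme \<Rightarrow> 'a set set" where
  "conjugacy_classes G =
     orbits G (carrier G) (\<lambda>g. \<lambda>h \<in> carrier G. g \<otimes>\<^bsub>G\<^esub> h \<otimes>\<^bsub>G\<^esub> (inv\<^bsub>G\<^esub> g))"

text \<open>A real eigenvalue $\pm 1$ contributes one (degenerate) pair. For elements of the compact
  symplectic group this is the number of distinct angles, see
  \<open>num_conjugate_pairs_conj_torus\<close> below.\<close>

definition num_conjugate_pairs :: "complex mat \<Rightarrow> nat" where
  "num_conjugate_pairs A = card ((\<lambda>z. {z, cnj z}) ` spectrum A)"

definition Sp_classes :: "nat \<Rightarrow> nat \<Rightarrow> nat \<Rightarrow> complex mat set set" where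
  "Sp_classes n m s = {C \<in> conjugacy_classes (compact_Sp n).
     \<forall>x\<in>C. x [^]\<^bsub>compact_Sp n\<^esub> m = \<one>\<^bsub>compact_Sp n\<^esub> \<and> num_conjugate_pairs x = s}"

definition N_Sp :: "nat \<Rightarrow> nat \<Rightarrow> nat \<Rightarrow> nat" where
  "N_Sp n m s = card (Sp_classes n m s)"


subsection \<open>Sanity checks\<close>

lemma mat_adjoint_carrier: "A \<in> carrier_mat d d \<Longrightarrow> mat_adjoint A \<in> carrier_mat d d"
  unfolding mat_adjoint_def by auto

lemma mat_adjoint_index:
  "A \<in> carrier_mat d d \<Longrightarrow> i < d \<Longrightarrow> j < d \<Longrightarrow> mat_adjoint A $$ (i,j) = conjugate (A $$ (j,i))"
  unfolding mat_adjoint_def by (auto simp: mat_of_rows_index)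

lemma mat_adjoint_mult:
  fixes A B :: "complex mat"
  assumes "A \<in> carrier_mat d d" "B \<in> carrier_mat d d"
  shows "mat_adjoint (A * B) = mat_adjoint B * mat_adjoint A"
proof (rule eq_matI)
  note c = assms mat_adjoint_carrier[OF assms(1)] mat_adjoint_carrier[OF assms(2)]
  fix i j assume "i < dim_row (mat_adjoint B * mat_adjoint A)"
    "j < dim_col (mat_adjoint B * mat_adjoint A)"
  hence ij: "i < d" "j < d" using c by auto
  have "mat_adjoint (A * B) $$ (i,j) = cnj ((A * B) $$ (j,i))"
    using mat_adjoint_index[of "A * B" d i j] ij assms by simp
  also have "\<dots> = (\<Sum>k\<in>{0..<d}. cnj (A $$ (j,k)) * cnj (B $$ (k,i)))"
    using ij assms by (simp add: scalar_prod_def)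
  also have "\<dots> = (\<Sum>k\<in>{0..<d}. mat_adjoint B $$ (i,k) * mat_adjoint A $$ (k,j))"
    using ij assms by (intro sum.cong) (auto simp: mat_adjoint_index)
  also have "\<dots> = (mat_adjoint B * mat_adjoint A) $$ (i,j)"
    using ij c by (simp add: scalar_prod_def)
  finally show "mat_adjoint (A * B) $$ (i,j) = (mat_adjoint B * mat_adjoint A) $$ (i,j)" .
qed (use assms mat_adjoint_carrier[OF assms(1)] mat_adjoint_carrier[OF assms(2)]
      mat_adjoint_carrier[of "A * B" d] in auto)

lemma mat_adjoint_adjoint:
  fixes A :: "complex mat"
  assumes "A \<in> carrier_mat d d"
  shows "mat_adjoint (mat_adjoint A) = A"
  by (rule eq_matI)
    (use assms mat_adjoint_carrier[OF assms] mat_adjoint_carrier[OF mat_adjoint_carrier[OF assms]]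
     in \<open>auto simp: mat_adjoint_index\<close>)

lemma mat_adjoint_one: "mat_adjoint (1\<^sub>m d :: complex mat) = 1\<^sub>m d"
  by (rule eq_matI)
    (use mat_adjoint_carrier[of "1\<^sub>m d :: complex mat" d] in
      \<open>auto simp: mat_adjoint_index[OF one_carrier_mat]\<close>)

lemma symplectic_form_mat_carrier: "symplectic_form_mat n \<in> carrier_mat (2 * n) (2 * n)"
  unfolding symplectic_form_mat_def by (auto simp: mult_2)

lemma Sp_complex_mult:
  assumes "A \<in> Sp_complex n" "B \<in> Sp_complex n"
  shows "A * B \<in> Sp_complex n"
proof -
  let ?J = "symplectic_form_mat n" and ?d = "2 * n"
  note J = symplectic_form_mat_carrier[of n]
  have A: "A \<in> carrier_mat ?d ?d" "transpose_mat A * ?J * A = ?J"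
    and B: "B \<in> carrier_mat ?d ?d" "transpose_mat B * ?J * B = ?J"
    using assms by (auto simp: Sp_complex_def)
  have "transpose_mat (A * B) * ?J * (A * B)
      = transpose_mat B * (transpose_mat A * ?J * A) * B"
    using A(1) B(1) J
    by (simp add: assoc_mult_mat[of _ ?d ?d _ ?d _ ?d] transpose_mult[of _ ?d ?d _ ?d])
  thus ?thesis using A B by (simp add: Sp_complex_def)
qed

lemma Sp_complex_inverse:
  assumes "A \<in> Sp_complex n" "B \<in> carrier_mat (2 * n) (2 * n)" "A * B = 1\<^sub>m (2 * n)"
  shows "B \<in> Sp_complex n"
proof -
  let ?J = "symplectic_form_mat n" and ?d = "2 * n"
  note J = symplectic_form_mat_carrier[of n]
  have A: "A \<in> carrier_mat ?d ?d" "transpose_mat A * ?J * A = ?J"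
    using assms by (auto simp: Sp_complex_def)
  have t: "transpose_mat B * transpose_mat A = 1\<^sub>m ?d"
    using transpose_mult[OF A(1) assms(2)] assms(3) by simp
  have "transpose_mat B * ?J * B = transpose_mat B * (transpose_mat A * ?J * A) * B"
    using A(2) by simp
  also have "\<dots> = (transpose_mat B * transpose_mat A) * ?J * (A * B)"
    using A(1) assms(2) J by (simp add: assoc_mult_mat[of _ ?d ?d _ ?d _ ?d])
  also have "\<dots> = ?J" using t assms(3) J by simp
  finally show ?thesis using assms(2) by (simp add: Sp_complex_def)
qed

lemma group_compact_Sp: "group (compact_Sp n)"
proof (rule groupI)
  let ?d = "2 * n"
  have unf: "carrier (compact_Sp n) = Sp_complex n \<inter> unitary_mats ?d"
    "monoid.mult (compact_Sp n) = (*)" "one (compact_Sp n) = 1\<^sub>m ?d"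
    by (auto simp: compact_Sp_def)
  { fix x y assume "x \<in> carrier (compact_Sp n)" "y \<in> carrier (compact_Sp n)"
    hence s: "x \<in> Sp_complex n" "y \<in> Sp_complex n"
      and x: "x \<in> carrier_mat ?d ?d" "mat_adjoint x * x = 1\<^sub>m ?d"
      and y: "y \<in> carrier_mat ?d ?d" "mat_adjoint y * y = 1\<^sub>m ?d"
      by (auto simp: unf unitary_mats_def)
    note c = x(1) y(1) mat_adjoint_carrier[OF x(1)] mat_adjoint_carrier[OF y(1)]
    have "mat_adjoint (x * y) * (x * y) = mat_adjoint y * ((mat_adjoint x * x) * y)"
      using c by (simp add: mat_adjoint_mult[OF x(1) y(1)] assoc_mult_mat[of _ ?d ?d _ ?d _ ?d])
    also have "\<dots> = 1\<^sub>m ?d" using x y by simp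
    finally show "x \<otimes>\<^bsub>compact_Sp n\<^esub> y \<in> carrier (compact_Sp n)"
      using s c Sp_complex_mult[OF s] by (simp add: unf unitary_mats_def) }
  show "\<one>\<^bsub>compact_Sp n\<^esub> \<in> carrier (compact_Sp n)"
    using symplectic_form_mat_carrier[of n]
    by (simp add: unf unitary_mats_def Sp_complex_def mat_adjoint_one)
  { fix x y z assume "x \<in> carrier (compact_Sp n)" "y \<in> carrier (compact_Sp n)"
      "z \<in> carrier (compact_Sp n)"
    thus "x \<otimes>\<^bsub>compact_Sp n\<^esub> y \<otimes>\<^bsub>compact_Sp n\<^esub> z = x \<otimes>\<^bsub>compact_Sp n\<^esub> (y \<otimes>\<^bsub>compact_Sp n\<^esub> z)"
      by (simp add: unf unitary_mats_def assoc_mult_mat[of _ ?d ?d _ ?d _ ?d]) }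
  { fix x assume "x \<in> carrier (compact_Sp n)"
    hence s: "x \<in> Sp_complex n" and x: "x \<in> carrier_mat ?d ?d" "mat_adjoint x * x = 1\<^sub>m ?d"
      by (auto simp: unf unitary_mats_def)
    note c = mat_adjoint_carrier[OF x(1)]
    have r: "x * mat_adjoint x = 1\<^sub>m ?d"
      by (rule mat_mult_left_right_inverse[OF c x])
    show "\<one>\<^bsub>compact_Sp n\<^esub> \<otimes>\<^bsub>compact_Sp n\<^esub> x = x" using x by (simp add: unf)
    show "\<exists>y\<in>carrier (compact_Sp n). y \<otimes>\<^bsub>compact_Sp n\<^esub> x = \<one>\<^bsub>compact_Sp n\<^esub>"
      using Sp_complex_inverse[OF s c r] c r x
      by (intro bexI[of _ "mat_adjoint x"])
        (auto simp: unf unitary_mats_def mat_adjoint_adjoint) }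
qed

definition torus_elt :: "nat \<Rightarrow> (nat \<Rightarrow> real) \<Rightarrow> complex mat" where
  "torus_elt n \<theta> = mat_diag (2 * n)
     (\<lambda>i. if i < n then cis (2 * pi * \<theta> i) else cis (- (2 * pi * \<theta> (i - n))))"

lemma spectrum_torus_elt:
  "spectrum (torus_elt n \<theta>) =
     (\<Union>l<n. {cis (2 * pi * \<theta> l), cis (- (2 * pi * \<theta> l))})"
proof -
  let ?f = "\<lambda>i. if i < n then cis (2 * pi * \<theta> i) else cis (- (2 * pi * \<theta> (i - n)))"
  let ?D = "torus_elt n \<theta>"
  have D: "?D \<in> carrier_mat (2 * n) (2 * n)" by (simp add: torus_elt_def mat_diag_def)
  have u: "upper_triangular ?D" by (auto simp: torus_elt_def mat_diag_def)
  have d: "diag_mat ?D = map ?f [0..<2 * n]"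
    by (auto simp: diag_mat_def torus_elt_def mat_diag_def)
  have "eigenvalue ?D k \<longleftrightarrow> k \<in> ?f ` {..<2 * n}" for k
  proof -
    have "eigenvalue ?D k \<longleftrightarrow> (\<exists>i<2 * n. k - ?f i = 0)"
      by (simp only: eigenvalue_root_char_poly[OF D] char_poly_upper_triangular[OF D u] d
          poly_prod_list prod_list_zero_iff) (force simp: image_iff)
    thus ?thesis by (simp only: right_minus_eq image_iff Bex_def lessThan_iff)
  qed
  hence "spectrum ?D = ?f ` {..<2 * n}"
    unfolding spectrum_def by blast
  also have "{..<2 * n} = {..<n} \<union> (\<lambda>l. l + n) ` {..<n}"
  proof (intro equalityI subsetI)
    fix i assume i: "i \<in> {..<2 * n}"
    show "i \<in> {..<n} \<union> (\<lambda>l. l + n) ` {..<n}"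
    proof (cases "i < n")
      case False
      hence "i = (i - n) + n" "i - n < n" using i by auto
      thus ?thesis by blast
    qed simp
  qed auto
  also have "?f ` \<dots> = (\<Union>l<n. {cis (2 * pi * \<theta> l), cis (- (2 * pi * \<theta> l))})"
    unfolding image_Un image_image by auto
  finally show ?thesis .
qed

lemma num_conjugate_pairs_torus_elt:
  assumes "\<And>l. l < n \<Longrightarrow> \<theta> l \<in> {0..1/2}"
  shows "num_conjugate_pairs (torus_elt n \<theta>) = card (\<theta> ` {..<n})"
proof -
  let ?p = "\<lambda>t. {cis (2 * pi * t), cis (- (2 * pi * t))}"
  have "(\<lambda>z. {z, cnj z}) ` spectrum (torus_elt n \<theta>) = ?p ` (\<theta> ` {..<n})"
    unfolding spectrum_torus_elt by (force simp: cis_cnj insert_commute)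
  moreover have "inj_on ?p (\<theta> ` {..<n})"
  proof (rule inj_onI)
    fix a b assume "a \<in> \<theta> ` {..<n}" "b \<in> \<theta> ` {..<n}" and eq: "?p a = ?p b"
    hence ab: "a \<in> {0..1/2}" "b \<in> {0..1/2}" using assms by auto
    from eq have "cis (2 * pi * a) = cis (2 * pi * b) \<or> cis (2 * pi * a) = cis (- (2 * pi * b))"
      by blast
    hence "Re (cis (2 * pi * a)) = Re (cis (2 * pi * b))"
      by (elim disjE) (drule arg_cong[of _ _ Re], simp)+
    hence "cos (2 * pi * a) = cos (2 * pi * b)" by simp
    moreover have "0 \<le> 2 * pi * a" "2 * pi * a \<le> pi" "0 \<le> 2 * pi * b" "2 * pi * b \<le> pi"
      using ab mult_left_mono[of a "1/2" "2 * pi"] mult_left_mono[of b "1/2" "2 * pi"] by auto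
    ultimately have "2 * pi * a = 2 * pi * b" using cos_inj_pi by blast
    thus "a = b" by simp
  qed
  ultimately show ?thesis unfolding num_conjugate_pairs_def by (simp add: card_image)
qed

lemma num_conjugate_pairs_conj_torus:
  assumes "g \<in> carrier (compact_Sp n)" "\<And>l. l < n \<Longrightarrow> \<theta> l \<in> {0..1/2}"
    and "x = g \<otimes>\<^bsub>compact_Sp n\<^esub> torus_elt n \<theta> \<otimes>\<^bsub>compact_Sp n\<^esub> inv\<^bsub>compact_Sp n\<^esub> g"
  shows "num_conjugate_pairs x = card (\<theta> ` {..<n})"
proof -
  interpret group "compact_Sp n" by (rule group_compact_Sp)
  let ?d = "2 * n" and ?D = "torus_elt n \<theta>" and ?h = "inv\<^bsub>compact_Sp n\<^esub> g"
  have h: "?h \<in> carrier (compact_Sp n)" using assms(1) by simp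
  have c: "g \<in> carrier_mat ?d ?d" "?h \<in> carrier_mat ?d ?d" "?D \<in> carrier_mat ?d ?d"
    using assms(1) h by (auto simp: compact_Sp_def unitary_mats_def torus_elt_def mat_diag_def)
  have "g * ?h = 1\<^sub>m ?d" "?h * g = 1\<^sub>m ?d" "x = g * ?D * ?h"
    using r_inv[OF assms(1)] l_inv[OF assms(1)] assms(3) by (simp_all add: compact_Sp_def)
  hence "similar_mat x ?D" using c by (intro similar_matI[of _ _ g ?h ?d]) auto
  hence cp: "char_poly x = char_poly ?D" by (rule char_poly_similar)
  have "x \<in> carrier_mat ?d ?d" using c \<open>x = g * ?D * ?h\<close> by simp
  hence "spectrum x = spectrum ?D"
    unfolding spectrum_def using cp eigenvalue_root_char_poly[of x ?d]
      eigenvalue_root_char_poly[OF c(3)] by (intro Collect_cong) simp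
  thus ?thesis
    using num_conjugate_pairs_torus_elt[OF assms(2)] by (simp add: num_conjugate_pairs_def)
qed

end

theory Submission
  imports Defs "HOL-Combinatorics.Permutations"
begin

text \<open>A unitary matrix is symplectic iff it commutes with the quaternionic structure
  \<open>j v = - J v\<^sup>c\<close>, and then its columns are \<open>v\<^sub>1, \<dots>, v\<^sub>n, j v\<^sub>1, \<dots>, j v\<^sub>n\<close>. If \<open>x\<^sup>m = 1\<close>, such a
  frame of eigenvectors of \<open>x\<close> is built one pair at a time: the orthogonal complement of the
  pairs found so far is invariant under \<open>x\<close> and \<open>j\<close>, averaging over the powers of \<open>x\<close> yields an
  eigenvector in it, and passing from \<open>v\<close> to \<open>j v\<close> conjugates the eigenvalue, so that
  all angles can be taken in \<open>{0, 1/m, \<dots>, [m/2]/m}\<close>. The frame may be permuted, so a class is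
  determined by the multiset of its angles; conversely the characteristic polynomial recovers that
  multiset. It remains to count the multisets of size \<open>n\<close> with \<open>s\<close> distinct elements among
  \<open>[m/2] + 1\<close>.\<close>

subsection \<open>Multisets with prescribed support\<close>

lemma mset_set_set_mset_subseteq: "mset_set (set_mset M) \<subseteq># M"
  by (simp add: subseteq_mset_def count_mset_set')

text \<open>Removing one copy of each element of \<open>S\<close> leaves an arbitrary multiset over
  \<open>S\<close> of size \<open>n - card S\<close>, and stars and bars counts these;
  \<open>binomial_symmetric\<close> then rewrites the lower index.\<close>

lemma card_multisets_fixed_support:
  assumes "finite S" "S \<noteq> {}" "n > 0"
  shows "card {M. set_mset M = S \<and> size M = n} = (n - 1) choose (card S - 1)"
proof (cases "card S \<le> n")
  case True
  have pos: "card S > 0" using assms by (simp add: card_gt_0_iff)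
  have "bij_betw (\<lambda>M. M - mset_set S) {M. set_mset M = S \<and> size M = n}
          (multisets_of_size S (n - card S))"
  proof (rule bij_betw_byWitness[where f' = "\<lambda>M. M + mset_set S"])
    have sub: "mset_set S \<subseteq># M" if "set_mset M = S" for M
      using that by (metis mset_set_set_mset_subseteq)
    show "\<forall>M\<in>{M. set_mset M = S \<and> size M = n}. M - mset_set S + mset_set S = M"
      using sub by auto
    show "(\<lambda>M. M - mset_set S) ` {M. set_mset M = S \<and> size M = n}
            \<subseteq> multisets_of_size S (n - card S)"
      using sub by (auto simp: multisets_of_size_def size_Diff_submset dest: in_diffD)
    show "(\<lambda>M. M + mset_set S) ` multisets_of_size S (n - card S)
            \<subseteq> {M. set_mset M = S \<and> size M = n}"
      using True assms by (auto simp: multisets_of_size_def)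
  qed auto
  hence "card {M. set_mset M = S \<and> size M = n} = (card S + (n - card S) - 1) choose (n - card S)"
    using card_multisets_of_size[OF assms(1)] by (simp add: bij_betw_same_card)
  also have "\<dots> = (n - 1) choose (card S - 1)"
    using True pos binomial_symmetric[of "card S - 1" "n - 1"] by simp
  finally show ?thesis .
next
  \<comment> \<open>With fewer than \<open>card S\<close> elements no multiset has support
    \<open>S\<close>, and the binomial coefficient vanishes as well.\<close>
  case False
  have "card (set_mset M) \<le> size M" for M :: "'a multiset"
    by (metis mset_set_set_mset_subseteq size_mset_mono size_mset_set)
  hence "{M. set_mset M = S \<and> size M = n} = {}" using False by fastforce
  moreover have "(n - 1) choose (card S - 1) = 0"
    using False assms(3) by (intro binomial_eq_0) linarith
  ultimately show ?thesis by (metis card.empty)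
qed

text \<open>Group the multisets by their support: there are \<open>card K choose s\<close> supports,
  and each carries the same number of multisets.\<close>

lemma card_multisets_support_size:
  assumes "finite K" "n > 0" "s > 0"
  shows "card {M \<in> multisets_of_size K n. card (set_mset M) = s}
    = ((n - 1) choose (s - 1)) * (card K choose s)"
proof -
  let ?F = "{S. S \<subseteq> K \<and> card S = s}" and ?B = "\<lambda>S. {M. set_mset M = S \<and> size M = n}"
  have "{M \<in> multisets_of_size K n. card (set_mset M) = s} = (\<Union>S\<in>?F. ?B S)"
    by (auto simp: multisets_of_size_def)
  also have "card \<dots> = (\<Sum>S\<in>?F. card (?B S))"
  proof (rule card_UN_disjoint)
    show "\<forall>S\<in>?F. finite (?B S)"
      using finite_multisets_of_size[OF assms(1), of n]
      by (auto elim!: rev_finite_subset simp: multisets_of_size_def)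
  qed (use assms(1) in auto)
  also have "\<dots> = (\<Sum>S\<in>?F. (n - 1) choose (s - 1))"
  proof (rule sum.cong)
    fix S assume S: "S \<in> ?F"
    hence "finite S" "S \<noteq> {}" using assms finite_subset by auto
    thus "card (?B S) = (n - 1) choose (s - 1)"
      using card_multisets_fixed_support[OF _ _ assms(2)] S by blast
  qed simp
  finally show ?thesis using n_subsets[OF assms(1)] by simp
qed

subsection \<open>The quaternionic structure\<close>

lemma cscalar_sum:
  fixes v w :: "complex vec"
  assumes "v \<in> carrier_vec d" "w \<in> carrier_vec d"
  shows "v \<bullet>c w = (\<Sum>i<d. v $ i * cnj (w $ i))"
  using assms by (auto simp: scalar_prod_def lessThan_atLeast0 intro!: sum.cong)

lemma cscalar_swap:
  fixes v w :: "complex vec"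
  assumes "v \<in> carrier_vec d" "w \<in> carrier_vec d"
  shows "w \<bullet>c v = cnj (v \<bullet>c w)"
  using assms by (simp add: cscalar_sum mult.commute)

lemma cscalar_adjoint:
  fixes A :: "complex mat"
  assumes "A \<in> carrier_mat d d" "v \<in> carrier_vec d" "u \<in> carrier_vec d"
  shows "(A *\<^sub>v v) \<bullet>c u = v \<bullet>c (mat_adjoint A *\<^sub>v u)"
proof -
  note adj = mat_adjoint_carrier[OF assms(1)]
  have "(A *\<^sub>v v) \<bullet>c u = (\<Sum>i<d. (\<Sum>j<d. A $$ (i,j) * v $ j) * cnj (u $ i))"
    using assms
    by (auto simp: cscalar_sum[of _ d] scalar_prod_def lessThan_atLeast0 intro!: sum.cong)
  also have "\<dots> = (\<Sum>j<d. \<Sum>i<d. A $$ (i,j) * v $ j * cnj (u $ i))"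
    unfolding sum_distrib_right by (rule sum.swap)
  also have "\<dots> = (\<Sum>j<d. v $ j * cnj (\<Sum>i<d. cnj (A $$ (i,j)) * u $ i))"
    by (simp add: sum_distrib_left mult_ac)
  also have "\<dots> = v \<bullet>c (mat_adjoint A *\<^sub>v u)"
    using assms adj
    by (auto simp: cscalar_sum[of _ d] scalar_prod_def lessThan_atLeast0 mat_adjoint_index
        simp del: cnj_sum intro!: sum.cong arg_cong[of _ _ cnj])
  finally show ?thesis .
qed

lemma mat_eq_iff_entries:
  assumes "A \<in> carrier_mat r c" "B \<in> carrier_mat r c"
  shows "A = B \<longleftrightarrow> (\<forall>i<r. \<forall>k<c. A $$ (i,k) = B $$ (i,k))"
  using assms by (auto intro!: eq_matI)

text \<open>The entries of \<open>mat_adjoint A * A\<close> are the inner products of the columns of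
  \<open>A\<close>.\<close>

lemma unitary_mats_iff_cols:
  "A \<in> unitary_mats d \<longleftrightarrow> A \<in> carrier_mat d d \<and>
     (\<forall>i<d. \<forall>k<d. col A i \<bullet>c col A k = (if i = k then 1 else 0))"
proof (cases "A \<in> carrier_mat d d")
  case True
  note adj = mat_adjoint_carrier[OF True]
  have entry: "(mat_adjoint A * A) $$ (k,i) = col A i \<bullet>c col A k" if "i < d" "k < d" for i k
    using that True adj
    by (auto simp: cscalar_sum[of _ d] scalar_prod_def lessThan_atLeast0 mat_adjoint_index
        mult.commute intro!: sum.cong)
  have "mat_adjoint A * A = 1\<^sub>m d \<longleftrightarrow>
      (\<forall>k<d. \<forall>i<d. (mat_adjoint A * A) $$ (k,i) = 1\<^sub>m d $$ (k,i))"
    using True adj by (subst mat_eq_iff_entries[of _ d d]) auto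
  thus ?thesis using True entry by (auto simp: unitary_mats_def)
qed (auto simp: unitary_mats_def)

lemma unitary_cscalar:
  assumes "A \<in> unitary_mats d" "v \<in> carrier_vec d" "w \<in> carrier_vec d"
  shows "(A *\<^sub>v v) \<bullet>c (A *\<^sub>v w) = v \<bullet>c w"
proof -
  have A: "A \<in> carrier_mat d d" "mat_adjoint A * A = 1\<^sub>m d"
    using assms(1) by (auto simp: unitary_mats_def)
  have "(A *\<^sub>v v) \<bullet>c (A *\<^sub>v w) = v \<bullet>c (mat_adjoint A *\<^sub>v (A *\<^sub>v w))"
    using assms A by (intro cscalar_adjoint) auto
  also have "mat_adjoint A *\<^sub>v (A *\<^sub>v w) = w"
    using assms A mat_adjoint_carrier[OF A(1)]
    by (simp add: assoc_mult_mat_vec[symmetric, of _ d d _ d])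
  finally show ?thesis .
qed

text \<open>The antilinear map \<open>v \<mapsto> - J v\<^sup>c\<close>, where \<open>J\<close> is \<^const>\<open>symplectic_form_mat\<close>
  and \<open>v\<^sup>c\<close> is the complex conjugate, i.e. multiplication by the quaternion \<open>j\<close>.\<close>

definition quat :: "nat \<Rightarrow> complex vec \<Rightarrow> complex vec" where
  "quat n v = vec (2 * n) (\<lambda>i. if i < n then - cnj (v $ (i + n)) else cnj (v $ (i - n)))"

lemma quat_carrier [simp]: "quat n v \<in> carrier_vec (2 * n)"
  by (simp add: quat_def)

lemma dim_vec_quat [simp]: "dim_vec (quat n v) = 2 * n"
  by (simp add: quat_def)

lemma quat_index:
  "i < n \<Longrightarrow> quat n v $ i = - cnj (v $ (i + n))"
  "i < n \<Longrightarrow> quat n v $ (i + n) = cnj (v $ i)"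
  by (auto simp: quat_def)

lemma quat_smult: "v \<in> carrier_vec (2 * n) \<Longrightarrow> quat n (c \<cdot>\<^sub>v v) = cnj c \<cdot>\<^sub>v quat n v"
  by (rule eq_vecI) (auto simp: quat_def)

lemma sum_lessThan_double:
  fixes f :: "nat \<Rightarrow> 'a :: comm_monoid_add"
  shows "(\<Sum>i<2 * n. f i) = (\<Sum>i<n. f i) + (\<Sum>i<n. f (i + n))"
proof -
  have "(\<Sum>i<2 * n. f i) = (\<Sum>i<n. f i) + (\<Sum>i=n..<n + n. f i)"
    by (simp add: lessThan_atLeast0 mult_2 sum.atLeastLessThan_concat)
  also have "(\<Sum>i=n..<n + n. f i) = (\<Sum>i<n. f (i + n))"
    using sum.shift_bounds_nat_ivl[of f 0 n n] by (simp add: lessThan_atLeast0)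
  finally show ?thesis .
qed

lemma cscalar_quat_quat:
  assumes "v \<in> carrier_vec (2 * n)" "w \<in> carrier_vec (2 * n)"
  shows "quat n v \<bullet>c quat n w = cnj (v \<bullet>c w)"
  using assms by (simp add: cscalar_sum[of _ "2 * n"] sum_lessThan_double quat_index add.commute)

text \<open>Up to sign, the inner product of \<open>v\<close> with \<open>quat n w\<close> is the
  symplectic form of \<open>v\<close> and \<open>w\<close>, which is bilinear and
  alternating.\<close>

lemma cscalar_quat_right:
  assumes "v \<in> carrier_vec (2 * n)" "w \<in> carrier_vec (2 * n)"
  shows "v \<bullet>c quat n w = - (w \<bullet>c quat n v)"
  unfolding cscalar_sum[OF assms(1) quat_carrier] cscalar_sum[OF assms(2) quat_carrier] sum_lessThan_double
  by (simp add: quat_index sum_negf mult.commute)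

lemma cscalar_quat_self:
  assumes "v \<in> carrier_vec (2 * n)"
  shows "v \<bullet>c quat n v = 0"
  using cscalar_quat_right[OF assms assms] by simp

section \<open>Symplectic unitary matrices described by their columns\<close>

lemma symplectic_form_mat_index:
  assumes "i < n" "k < n"
  shows "symplectic_form_mat n $$ (i, k) = 0"
    "symplectic_form_mat n $$ (i, k + n) = (if i = k then 1 else 0)"
    "symplectic_form_mat n $$ (i + n, k) = (if i = k then - 1 else 0)"
    "symplectic_form_mat n $$ (i + n, k + n) = 0"
  using assms by (auto simp: symplectic_form_mat_def)

lemma all_less_double: "(\<forall>i<2 * n. P i) \<longleftrightarrow> (\<forall>i<n. P i \<and> P (i + n))" for n :: nat
proof (intro iffI allI impI)
  fix i assume a: "\<forall>i<n. P i \<and> P (i + n)" "i < 2 * n"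
  show "P i"
  proof (cases "i < n")
    case False
    hence "i - n < n" "i - n + n = i" using a(2) by auto
    thus ?thesis using a(1) by metis
  qed (use a in auto)
qed auto

lemma symplectic_form_mat_commute_iff:
  assumes A: "A \<in> carrier_mat (2 * n) (2 * n)"
  shows "symplectic_form_mat n * A = map_mat cnj A * symplectic_form_mat n
    \<longleftrightarrow> (\<forall>k<n. col A (k + n) = quat n (col A k))"
proof -
  let ?J = "symplectic_form_mat n"
  note J = symplectic_form_mat_carrier[of n]
  have mult: "(B * C) $$ (i,k) = (\<Sum>l<n. B $$ (i,l) * C $$ (l,k)) + (\<Sum>l<n. B $$ (i,l+n) * C $$ (l+n,k))"
    if "B \<in> carrier_mat (2*n) (2*n)" "C \<in> carrier_mat (2*n) (2*n)" "i < 2 * n" "k < 2 * n"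
    for B C :: "complex mat" and i k
    using that by (simp add: scalar_prod_def sum_lessThan_double lessThan_atLeast0[symmetric])
  have l: "(?J * A) $$ (i,k) = A $$ (i + n,k)" "(?J * A) $$ (i + n,k) = - A $$ (i,k)"
    if "i < n" "k < 2 * n" for i k
    using that J A by (simp_all del: index_mult_mat(1) add: mult symplectic_form_mat_index if_distrib[of "\<lambda>x. x * _"] cong: if_cong)
  have r: "(map_mat cnj A * ?J) $$ (i,k) = - cnj (A $$ (i,k+n))"
    "(map_mat cnj A * ?J) $$ (i,k + n) = cnj (A $$ (i,k))"
    if "i < 2 * n" "k < n" for i k
    using that J A by (simp_all del: index_mult_mat(1) add: mult symplectic_form_mat_index if_distrib[of "\<lambda>x. _ * x"] cong: if_cong)
  \<comment> \<open>The four blocks give four equations for the entries; the last two are the first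
    two conjugated, so two conditions remain, which are those on column
    \<open>k + n\<close>.\<close>
  have cnj_iff: "c = - cnj b \<and> e = cnj a \<and> - a = - cnj e \<and> - b = cnj c
      \<longleftrightarrow> b = - cnj c \<and> e = cnj a" for a b c e
    by (auto simp: complex_eq_iff)
  have "?J * A = map_mat cnj A * ?J \<longleftrightarrow>
      (\<forall>i<2*n. \<forall>k<2*n. (?J * A) $$ (i,k) = (map_mat cnj A * ?J) $$ (i,k))"
    using A J by (intro mat_eq_iff_entries) auto
  also have "\<dots> \<longleftrightarrow> (\<forall>i<n. \<forall>k<n.
     A $$ (i+n,k) = - cnj (A $$ (i,k+n)) \<and> A $$ (i+n,k+n) = cnj (A $$ (i,k))
     \<and> - A $$ (i,k) = - cnj (A $$ (i+n,k+n)) \<and> - A $$ (i,k+n) = cnj (A $$ (i+n,k)))"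
    by (simp add: all_less_double l r imp_conjR all_conj_distrib conj_ac del: index_mult_mat)
  also have "\<dots> \<longleftrightarrow> (\<forall>k<n. \<forall>i<n.
     A $$ (i,k+n) = - cnj (A $$ (i+n,k)) \<and> A $$ (i+n,k+n) = cnj (A $$ (i,k)))"
    unfolding cnj_iff by blast
  also have "\<dots> \<longleftrightarrow> (\<forall>k<n. \<forall>i<2*n. col A (k+n) $ i = quat n (col A k) $ i)"
    unfolding all_less_double using A by (auto simp: quat_index)
  also have "\<dots> \<longleftrightarrow> (\<forall>k<n. col A (k + n) = quat n (col A k))"
    using A by (simp add: vec_eq_iff)
  finally show ?thesis .
qed

text \<open>For unitary \<open>A\<close> the inverse of the transpose is the entrywise conjugate, so
  the symplectic condition can be rewritten as the commutation relation of
  \<open>symplectic_form_mat_commute_iff\<close>.\<close>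

lemma compact_Sp_iff_cols:
  "A \<in> carrier (compact_Sp n) \<longleftrightarrow>
     A \<in> unitary_mats (2 * n) \<and> (\<forall>k<n. col A (k + n) = quat n (col A k))"
proof (cases "A \<in> unitary_mats (2 * n)")
  case True
  let ?J = "symplectic_form_mat n" and ?d = "2 * n" and ?C = "map_mat cnj A"
  note J = symplectic_form_mat_carrier[of n]
  have A: "A \<in> carrier_mat ?d ?d" "mat_adjoint A * A = 1\<^sub>m ?d"
    using True by (auto simp: unitary_mats_def)
  have C: "?C \<in> carrier_mat ?d ?d" "transpose_mat A \<in> carrier_mat ?d ?d" using A by auto
  note adj = mat_adjoint_carrier[OF A(1)]
  have "transpose_mat A * ?C = map_mat cnj (mat_adjoint A * A)"
    using A(1) adj by (intro eq_matI) (auto simp: scalar_prod_def mat_adjoint_index)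
  also have "\<dots> = 1\<^sub>m ?d" unfolding A(2) by (intro eq_matI) auto
  finally have TC: "transpose_mat A * ?C = 1\<^sub>m ?d" .
  hence CT: "?C * transpose_mat A = 1\<^sub>m ?d"
    using mat_mult_left_right_inverse C by blast
  have "transpose_mat A * ?J * A = ?J \<longleftrightarrow> ?J * A = ?C * ?J"
  proof
    assume "transpose_mat A * ?J * A = ?J"
    hence "?C * ?J = ?C * (transpose_mat A * (?J * A))"
      using A(1) C J by (simp add: assoc_mult_mat[of _ ?d ?d _ ?d _ ?d])
    also have "\<dots> = (?C * transpose_mat A) * (?J * A)"
      using A(1) C J by (simp add: assoc_mult_mat[of _ ?d ?d _ ?d _ ?d])
    finally show "?J * A = ?C * ?J" using CT A(1) J by simp
  next
    assume eq: "?J * A = ?C * ?J"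
    have "transpose_mat A * ?J * A = transpose_mat A * (?C * ?J)"
      unfolding eq[symmetric] using A(1) C J by (simp add: assoc_mult_mat[of _ ?d ?d _ ?d _ ?d])
    also have "\<dots> = (transpose_mat A * ?C) * ?J"
      using C J by (simp add: assoc_mult_mat[of _ ?d ?d _ ?d _ ?d])
    finally show "transpose_mat A * ?J * A = ?J" using TC J by simp
  qed
  thus ?thesis
    using True A(1) symplectic_form_mat_commute_iff[OF A(1)] by (simp add: compact_Sp_def Sp_complex_def)
qed (simp add: compact_Sp_def)

text \<open>The column condition is the case where \<open>v\<close> is one of the first
  \<open>n\<close> basis vectors. Entrywise it fixes the right half of the blocks of
  \<open>A\<close> in terms of the left half, and this gives the claim for all
  \<open>v\<close>.\<close>

lemma compact_Sp_quat_commute: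
  assumes "A \<in> carrier (compact_Sp n)" "v \<in> carrier_vec (2 * n)"
  shows "A *\<^sub>v quat n v = quat n (A *\<^sub>v v)"
proof (rule eq_vecI)
  have A: "A \<in> carrier_mat (2*n) (2*n)" and c: "\<And>k. k < n \<Longrightarrow> col A (k + n) = quat n (col A k)"
    using assms(1) by (auto simp: compact_Sp_iff_cols unitary_mats_def)
  have e: "A $$ (i, k + n) = - cnj (A $$ (i + n, k))" "A $$ (i + n, k + n) = cnj (A $$ (i, k))"
    if "i < n" "k < n" for i k
    using arg_cong[OF c[OF that(2)], of "\<lambda>v. v $ i"] arg_cong[OF c[OF that(2)], of "\<lambda>v. v $ (i + n)"] A that
    by (auto simp: quat_index)
  have mv: "(A *\<^sub>v w) $ i = (\<Sum>l<n. A $$ (i,l) * w $ l) + (\<Sum>l<n. A $$ (i,l+n) * w $ (l+n))"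
    if "w \<in> carrier_vec (2*n)" "i < 2 * n" for w i
    using that A by (simp add: scalar_prod_def sum_lessThan_double lessThan_atLeast0[symmetric])
  have "\<forall>i<2*n. (A *\<^sub>v quat n v) $ i = quat n (A *\<^sub>v v) $ i"
    unfolding all_less_double using assms(2)
    by (simp add: mv quat_index e sum_negf)
  thus "(A *\<^sub>v quat n v) $ i = quat n (A *\<^sub>v v) $ i" if "i < dim_vec (quat n (A *\<^sub>v v))" for i
    using that by (simp add: quat_def)
qed (use assms in \<open>auto simp: quat_def compact_Sp_def unitary_mats_def\<close>)

subsection \<open>Eigenvectors of matrices of finite order\<close>

lemma pow_mat_mult_vec:
  assumes "A \<in> carrier_mat d d" "v \<in> carrier_vec d"
  shows "A *\<^sub>v (A ^\<^sub>m i *\<^sub>v v) = A ^\<^sub>m Suc i *\<^sub>v v"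
proof -
  have "A * A ^\<^sub>m i = A ^\<^sub>m i * A" for i
    using assms(1) by (induction i) (auto simp: assoc_mult_mat[symmetric, of _ d d _ d _ d])
  thus ?thesis using assms by (simp add: assoc_mult_mat_vec[symmetric, of _ d d _ d])
qed

text \<open>A geometric sum whose ratio is an \<open>m\<close>-th root of unity; the ratio differs
  from 1 for \<open>0 < i < m\<close>, since otherwise \<open>m\<close> would divide
  \<open>i\<close>.\<close>

lemma sum_roots_of_unity:
  assumes "m > 0" "i < m"
  shows "(\<Sum>k<m. cis (- (2 * pi * (real k * real i / real m)))) = (if i = 0 then of_nat m else 0)"
proof (cases "i = 0")
  case False
  let ?z = "cis (- (2 * pi * (real i / real m)))"
  have "?z \<noteq> 1"
  proof
    assume "?z = 1"
    hence "cos (2 * pi * (real i / real m)) = 1" by (simp add: complex_eq_iff)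
    then obtain q where "2 * pi * (real i / real m) = real_of_int q * 2 * pi"
      using cos_one_2pi_int by blast
    hence "real i = real_of_int q * real m" using assms by (simp add: field_simps)
    hence "int i = q * int m" by (metis of_int_eq_iff of_int_mult of_int_of_nat_eq)
    moreover have "0 < int i" "int i < int m" using False assms by auto
    ultimately show False
      by (metis dvd_triv_right zdvd_not_zless)
  qed
  moreover have "?z ^ m = 1"
    using assms cis_multiple_2pi[of "- real i"] by (simp add: DeMoivre)
  moreover have "cis (- (2 * pi * (real k * real i / real m))) = ?z ^ k" for k
    by (simp add: DeMoivre mult_ac)
  ultimately show ?thesis using False by (simp add: sum_gp_strict)
qed simp

text \<open>The eigenvector is one of the components
  \<open>z k = \<Sum>i<m. cis (- 2 \<pi> k i / m) A\<^sup>i w\<close> of \<open>w\<close>, whose sum is \<open>m w\<close>.\<close>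

lemma finite_order_eigenvector:
  fixes A :: "complex mat"
  assumes A: "A \<in> carrier_mat d d" and ord: "A ^\<^sub>m m = 1\<^sub>m d" and "m > 0"
    and w: "w \<in> carrier_vec d" "w \<noteq> 0\<^sub>v d"
  obtains k z where "k < m" "z \<in> carrier_vec d" "z \<noteq> 0\<^sub>v d"
    "A *\<^sub>v z = cis (2 * pi * (real k / real m)) \<cdot>\<^sub>v z"
    "\<And>u. u \<in> carrier_vec d \<Longrightarrow> (\<And>i. (A ^\<^sub>m i *\<^sub>v w) \<bullet>c u = 0) \<Longrightarrow> z \<bullet>c u = 0"
proof -
  define y where "y i = A ^\<^sub>m i *\<^sub>v w" for i
  define c where "c k i = cis (- (2 * pi * (real k * real i / real m)))" for k i :: nat
  define z where "z k = vec d (\<lambda>a. \<Sum>i<m. c k i * y i $ a)" for k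
  have y: "y i \<in> carrier_vec d" for i
    using A w by (auto simp: y_def intro!: mult_mat_vec_carrier[of _ d d])
  have z: "z k \<in> carrier_vec d" for k by (simp add: z_def)
  have ym: "y m = y 0" using ord A w by (simp add: y_def)
  have Ay: "A *\<^sub>v y i = y (Suc i)" for i
    using pow_mat_mult_vec[OF A w(1)] by (simp add: y_def)
  \<comment> \<open>At a coordinate \<open>a\<close> where \<open>w\<close> is nonzero, the sum over
    \<open>k\<close> retains only the term \<open>i = 0\<close> and equals \<open>m\<close> times
    that coordinate of \<open>w\<close>. Hence some \<open>z k\<close> is nonzero at
    \<open>a\<close>.\<close>
  obtain a where a: "a < d" "w $ a \<noteq> 0" using w by (metis carrier_vecD eq_vecI index_zero_vec)
  have "(\<Sum>k<m. z k $ a) = (\<Sum>i<m. (\<Sum>k<m. c k i) * y i $ a)"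
    unfolding sum_distrib_right using a by (simp add: z_def, subst sum.swap) simp
  also have "\<dots> = (\<Sum>i<m. if i = 0 then of_nat m * y i $ a else 0)"
    using sum_roots_of_unity[OF \<open>m > 0\<close>] by (intro sum.cong) (auto simp: c_def)
  also have "\<dots> = of_nat m * w $ a" using \<open>m > 0\<close> A w by (simp add: y_def)
  finally have "(\<Sum>k<m. z k $ a) \<noteq> 0" using a \<open>m > 0\<close> by simp
  then obtain k where k: "k < m" "z k $ a \<noteq> 0" by (metis lessThan_iff sum.neutral)
  let ?\<zeta> = "cis (2 * pi * (real k / real m))"
  have shift: "c k i = ?\<zeta> * c k (Suc i)" for i
    by (simp add: c_def cis_mult) (simp add: field_simps add_divide_distrib)
  have cm: "c k m = c k 0" using \<open>m > 0\<close> cis_multiple_2pi[of "- real k"] by (simp add: c_def)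
  have "A *\<^sub>v z k = ?\<zeta> \<cdot>\<^sub>v z k"
  proof (rule eq_vecI)
    fix b assume "b < dim_vec (?\<zeta> \<cdot>\<^sub>v z k)"
    hence b: "b < d" by (simp add: z_def)
    have "(A *\<^sub>v z k) $ b = (\<Sum>e<d. A $$ (b,e) * (\<Sum>i<m. c k i * y i $ e))"
      using A b by (simp add: z_def scalar_prod_def lessThan_atLeast0)
    also have "\<dots> = (\<Sum>i<m. c k i * (\<Sum>e<d. A $$ (b,e) * y i $ e))"
      unfolding sum_distrib_left by (subst sum.swap) (simp add: mult_ac)
    also have "\<dots> = (\<Sum>i<m. c k i * (A *\<^sub>v y i) $ b)"
      using A b y[THEN carrier_vecD] by (simp add: scalar_prod_def lessThan_atLeast0)
    also have "\<dots> = ?\<zeta> * (\<Sum>i<m. c k (Suc i) * y (Suc i) $ b)"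
      unfolding Ay sum_distrib_left by (subst shift) (simp add: mult_ac)
    also have "(\<Sum>i<m. c k (Suc i) * y (Suc i) $ b) = (\<Sum>i<m. c k i * y i $ b)"
      using sum.lessThan_Suc_shift[of "\<lambda>i. c k i * y i $ b" m] ym cm by simp
    \<comment> \<open>The shifted sum is the original one because the terms for \<open>0\<close> and
      \<open>m\<close> coincide: \<open>y m = y 0\<close> by the order of \<open>A\<close>, and
      \<open>c k m = c k 0\<close>.\<close>
    finally show "(A *\<^sub>v z k) $ b = (?\<zeta> \<cdot>\<^sub>v z k) $ b" using b by (simp add: z_def)
  qed (use A z[of k] in auto)
  moreover have "z k \<bullet>c u = 0" if u: "u \<in> carrier_vec d" "\<And>i. (A ^\<^sub>m i *\<^sub>v w) \<bullet>c u = 0" for u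
  proof -
    have "z k \<bullet>c u = (\<Sum>e<d. (\<Sum>i<m. c k i * y i $ e) * cnj (u $ e))"
      using z u by (simp add: cscalar_sum[of _ d]) (simp add: z_def)
    also have "\<dots> = (\<Sum>i<m. c k i * (\<Sum>e<d. y i $ e * cnj (u $ e)))"
      unfolding sum_distrib_left sum_distrib_right by (subst sum.swap) (simp add: mult_ac)
    also have "\<dots> = (\<Sum>i<m. c k i * (y i \<bullet>c u))" using y u by (simp add: cscalar_sum[of _ d])
    finally show ?thesis using u(2) by (simp add: y_def)
  qed
  moreover have "z k \<noteq> 0\<^sub>v d" using k a by auto
  ultimately show ?thesis using that[of k "z k"] k z by blast
qed

text \<open>The conjugated vectors, padded with zero rows, form a singular square matrix; a nonzero
  kernel vector is orthogonal to all of them.\<close>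

lemma exists_orthogonal_vec:
  fixes us :: "complex vec list"
  assumes "set us \<subseteq> carrier_vec d" "length us < d"
  obtains w where "w \<in> carrier_vec d" "w \<noteq> 0\<^sub>v d" "\<And>u. u \<in> set us \<Longrightarrow> w \<bullet>c u = 0"
proof -
  let ?l = "length us"
  let ?f = "\<lambda>i. if i < ?l then conjugate (us ! i) else 0\<^sub>v d"
  \<comment> \<open>The row with index \<open>?l\<close> is zero and singled out so that
    \<open>det_row_0\<close> applies; it exists since \<open>?l < d\<close>.\<close>
  let ?M = "mat\<^sub>r d d (\<lambda>i. if i = ?l then 0\<^sub>v d else ?f i)"
  have f: "?f \<in> {0..<d} \<rightarrow> carrier_vec d" using assms(1) by (auto simp: subset_iff)
  have M: "?M \<in> carrier_mat d d" by simp
  have "det ?M = 0" using det_row_0[OF assms(2) f] .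
  then obtain w where w: "w \<in> carrier_vec d" "w \<noteq> 0\<^sub>v d" "?M *\<^sub>v w = 0\<^sub>v d"
    using det_0_iff_vec_prod_zero[OF M] by blast
  have "w \<bullet>c u = 0" if "u \<in> set us" for u
  proof -
    obtain i where i: "i < ?l" "u = us ! i" using \<open>u \<in> set us\<close> by (metis in_set_conv_nth)
    have u: "u \<in> carrier_vec d" using assms(1) that by auto
    have "row ?M i = conjugate u"
      using i assms(2) u by (subst row_mat_of_row_fun) auto
    moreover have "(?M *\<^sub>v w) $ i = row ?M i \<bullet> w" using i assms(2) by simp
    ultimately have "conjugate u \<bullet> w = 0" using w i assms(2) by simp
    thus ?thesis using conjugate_vec_sprod_comm[OF w(1) u] by simp
  qed
  thus ?thesis using w that by blast
qed

subsection \<open>Diagonalization in the compact symplectic group\<close>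

text \<open>Encodes orthonormality of the \<open>2 * k\<close> vectors \<open>v i\<close> and
  \<open>quat n (v i)\<close>: products with \<open>quat\<close> on the left follow from these by
  conjugation.\<close>

definition quat_orthonormal :: "nat \<Rightarrow> nat \<Rightarrow> (nat \<Rightarrow> complex vec) \<Rightarrow> bool" where
  "quat_orthonormal n k v \<longleftrightarrow> (\<forall>i<k. v i \<in> carrier_vec (2 * n)) \<and>
     (\<forall>i<k. \<forall>l<k. v i \<bullet>c v l = (if i = l then 1 else 0) \<and> v i \<bullet>c quat n (v l) = 0)"

definition quat_frame :: "nat \<Rightarrow> (nat \<Rightarrow> complex vec) \<Rightarrow> complex mat" where
  "quat_frame n v = mat (2 * n) (2 * n)
     (\<lambda>(i,k). if k < n then v k $ i else quat n (v (k - n)) $ i)"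

lemma quat_frame_carrier: "quat_frame n v \<in> carrier_mat (2 * n) (2 * n)"
  by (simp add: quat_frame_def)

lemma col_quat_frame:
  assumes "k < n" "v k \<in> carrier_vec (2 * n)"
  shows "col (quat_frame n v) k = v k" "col (quat_frame n v) (k + n) = quat n (v k)"
  using assms by (auto simp: quat_frame_def vec_eq_iff)

lemma quat_frame_in_compact_Sp:
  assumes "quat_orthonormal n n v"
  shows "quat_frame n v \<in> carrier (compact_Sp n)"
proof -
  have v: "v i \<in> carrier_vec (2 * n)" if "i < n" for i
    using assms that by (simp add: quat_orthonormal_def)
  have o: "v i \<bullet>c v l = (if i = l then 1 else 0)" "v i \<bullet>c quat n (v l) = 0"
    "quat n (v i) \<bullet>c v l = 0" "quat n (v i) \<bullet>c quat n (v l) = (if i = l then 1 else 0)"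
    if "i < n" "l < n" for i l
    using assms that v cscalar_swap[OF v[OF that(2)] quat_carrier, of "v i"]
    by (auto simp: quat_orthonormal_def cscalar_quat_quat)
  show ?thesis
    unfolding compact_Sp_iff_cols unitary_mats_iff_cols all_less_double
    using quat_frame_carrier by (auto simp: col_quat_frame v o)
qed

lemma torus_elt_carrier: "torus_elt n \<theta> \<in> carrier_mat (2 * n) (2 * n)"
  by (simp add: torus_elt_def mat_diag_def)

lemma torus_elt_in_compact_Sp: "torus_elt n \<theta> \<in> carrier (compact_Sp n)"
proof -
  note c = torus_elt_carrier[of n \<theta>]
  have cols: "col (torus_elt n \<theta>) k = vec (2 * n) (\<lambda>i. if i = k then cis (2 * pi * \<theta> k) else 0)"
    "col (torus_elt n \<theta>) (k + n) = vec (2 * n) (\<lambda>i. if i = k + n then cis (- (2 * pi * \<theta> k)) else 0)"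
    if "k < n" for k
    using that by (auto simp: torus_elt_def mat_diag_def vec_eq_iff)
  show ?thesis
    unfolding compact_Sp_iff_cols unitary_mats_iff_cols all_less_double
    using c by (auto simp: cols cscalar_sum[of _ "2 * n"] if_distrib[of "\<lambda>x. x * _"]
        if_distrib[of cnj] cis_cnj cis_mult vec_eq_iff quat_def cong: if_cong)
qed

text \<open>With the frame as the matrix \<open>g\<close>, the equation \<open>x * g = g * T\<close>
  for the torus element \<open>T\<close> says column by column that the columns of \<open>g\<close>
  are eigenvectors.\<close>

lemma conj_torus_of_eigenframe:
  assumes x: "x \<in> carrier (compact_Sp n)" and v: "quat_orthonormal n n v"
    and eig: "\<And>i. i < n \<Longrightarrow> x *\<^sub>v v i = cis (2 * pi * \<theta> i) \<cdot>\<^sub>v v i"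
  shows "\<exists>g\<in>carrier (compact_Sp n).
    x = g \<otimes>\<^bsub>compact_Sp n\<^esub> torus_elt n \<theta> \<otimes>\<^bsub>compact_Sp n\<^esub> inv\<^bsub>compact_Sp n\<^esub> g"
proof
  interpret group "compact_Sp n" by (rule group_compact_Sp)
  let ?g = "quat_frame n v" and ?T = "torus_elt n \<theta>"
  note gc = quat_frame_carrier[of n v] and Tc = torus_elt_carrier[of n \<theta>]
  show g: "?g \<in> carrier (compact_Sp n)" by (rule quat_frame_in_compact_Sp[OF v])
  have xc: "x \<in> carrier_mat (2 * n) (2 * n)" using x by (simp add: compact_Sp_iff_cols unitary_mats_def)
  have vc: "v i \<in> carrier_vec (2 * n)" if "i < n" for i
    using v that by (simp add: quat_orthonormal_def)
  have gT: "col (?g * ?T) k = (if k < n then cis (2 * pi * \<theta> k) else cis (- (2 * pi * \<theta> (k - n)))) \<cdot>\<^sub>v col ?g k"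
    if "k < 2 * n" for k
    using that gc Tc unfolding torus_elt_def by (auto simp: mat_diag_mult_right[OF gc] vec_eq_iff)
  have xg: "col (x * ?g) k = x *\<^sub>v col ?g k" if "k < 2 * n" for k
    using that xc gc by (intro col_mult2) auto
  \<comment> \<open>On the last \<open>n\<close> columns \<open>x\<close> commutes with
    \<open>quat\<close>, whose antilinearity conjugates the eigenvalue, as the second half of the
    torus diagonal requires.\<close>
  have "\<forall>k<2*n. col (x * ?g) k = col (?g * ?T) k"
    unfolding all_less_double
    by (auto simp: xg gT col_quat_frame vc eig compact_Sp_quat_commute[OF x] quat_smult cis_cnj)
  hence "x * ?g = ?g * ?T"
    using xc gc Tc by (intro mat_col_eqI) auto
  hence "x \<otimes>\<^bsub>compact_Sp n\<^esub> ?g = ?g \<otimes>\<^bsub>compact_Sp n\<^esub> ?T" by (simp add: compact_Sp_def)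
  thus "x = ?g \<otimes>\<^bsub>compact_Sp n\<^esub> ?T \<otimes>\<^bsub>compact_Sp n\<^esub> inv\<^bsub>compact_Sp n\<^esub> ?g"
    using x g torus_elt_in_compact_Sp[of n \<theta>] by (metis inv_solve_right' m_closed)
qed

lemma compact_Sp_nat_pow: "x [^]\<^bsub>compact_Sp n\<^esub> k = x ^\<^sub>m k" if "x \<in> carrier (compact_Sp n)"
proof -
  have "dim_row x = 2 * n" using that by (auto simp: compact_Sp_iff_cols unitary_mats_def)
  thus ?thesis by (induction k) (auto simp: compact_Sp_def nat_pow_def)
qed

lemma exists_quat_eigenframe:
  assumes x: "x \<in> carrier (compact_Sp n)" and ord: "x ^\<^sub>m m = 1\<^sub>m (2 * n)" and "m > 0"
    and "k \<le> n"
  shows "\<exists>v t. quat_orthonormal n k v \<and>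
    (\<forall>i<k. t i \<le> m div 2 \<and> x *\<^sub>v v i = cis (2 * pi * (real (t i) / real m)) \<cdot>\<^sub>v v i)"
  using \<open>k \<le> n\<close>
proof (induction k)
  case 0
  show ?case by (simp add: quat_orthonormal_def)
next
  case (Suc k)
  let ?d = "2 * n" and ?ev = "\<lambda>t. cis (2 * pi * (real t / real m))"
  have xU: "x \<in> unitary_mats ?d" and xc: "x \<in> carrier_mat ?d ?d"
    using x by (auto simp: compact_Sp_iff_cols unitary_mats_def)
  obtain v t where v: "quat_orthonormal n k v"
    and t: "\<And>i. i < k \<Longrightarrow> t i \<le> m div 2" and eig: "\<And>i. i < k \<Longrightarrow> x *\<^sub>v v i = ?ev (t i) \<cdot>\<^sub>v v i"
    using Suc by auto
  have vc: "v i \<in> carrier_vec ?d" if "i < k" for i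
    using v that by (simp add: quat_orthonormal_def)
  \<comment> \<open>These are \<open>2 * k < 2 * n\<close> vectors, so a nonzero \<open>w\<close>
    orthogonal to all of them exists.\<close>
  define us where "us = map v [0..<k] @ map (\<lambda>i. quat n (v i)) [0..<k]"
  have "set us \<subseteq> carrier_vec ?d" "length us < ?d" using vc Suc.prems by (auto simp: us_def)
  then obtain w where w: "w \<in> carrier_vec ?d" "w \<noteq> 0\<^sub>v ?d" "\<And>u. u \<in> set us \<Longrightarrow> w \<bullet>c u = 0"
    using exists_orthogonal_vec by blast
  \<comment> \<open>Orthogonality to an eigenvector \<open>u\<close> survives applying
    \<open>x\<close>: unitarity preserves the inner product, and \<open>x\<close> only rescales
    \<open>u\<close> by \<open>c \<noteq> 0\<close>.\<close>
  have inv: "(x ^\<^sub>m j *\<^sub>v w) \<bullet>c u = 0"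
    if "w \<bullet>c u = 0" "u \<in> carrier_vec ?d" "x *\<^sub>v u = c \<cdot>\<^sub>v u" "c \<noteq> 0" for u c j
  proof (induction j)
    case (Suc j)
    let ?y = "x ^\<^sub>m j *\<^sub>v w"
    have y: "?y \<in> carrier_vec ?d" using xc w by (auto intro!: mult_mat_vec_carrier[of _ ?d ?d])
    have "cnj c * ((x *\<^sub>v ?y) \<bullet>c u) = (x *\<^sub>v ?y) \<bullet>c (x *\<^sub>v u)"
      using that xc y by (simp add: conjugate_smult_vec)
    also have "\<dots> = 0" using unitary_cscalar[OF xU y that(2)] Suc by simp
    finally show ?case using \<open>c \<noteq> 0\<close> pow_mat_mult_vec[OF xc w(1)] by simp
  qed (use that xc w in simp)
  have orth: "(x ^\<^sub>m j *\<^sub>v w) \<bullet>c v i = 0" "(x ^\<^sub>m j *\<^sub>v w) \<bullet>c quat n (v i) = 0" if "i < k" for i j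
  proof -
    show "(x ^\<^sub>m j *\<^sub>v w) \<bullet>c v i = 0"
      using that by (intro inv[OF _ vc eig] w(3)) (auto simp: us_def)
    have "x *\<^sub>v quat n (v i) = cnj (?ev (t i)) \<cdot>\<^sub>v quat n (v i)"
      using that by (simp add: compact_Sp_quat_commute[OF x] vc eig quat_smult)
    thus "(x ^\<^sub>m j *\<^sub>v w) \<bullet>c quat n (v i) = 0"
      using that by (intro inv[of _ "cnj (?ev (t i))"] w(3)) (auto simp: us_def)
  qed
  obtain r z where r: "r < m" and z: "z \<in> carrier_vec ?d" "z \<noteq> 0\<^sub>v ?d" "x *\<^sub>v z = ?ev r \<cdot>\<^sub>v z"
    and zo: "\<And>u. u \<in> carrier_vec ?d \<Longrightarrow> (\<And>i. (x ^\<^sub>m i *\<^sub>v w) \<bullet>c u = 0) \<Longrightarrow> z \<bullet>c u = 0"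
    using finite_order_eigenvector[OF xc ord \<open>m > 0\<close> w(1,2)] by metis
  have zv: "z \<bullet>c v i = 0" "z \<bullet>c quat n (v i) = 0" if "i < k" for i
    using orth[OF that] zo vc[OF that] by auto
  have "\<exists>r z. r \<le> m div 2 \<and> z \<in> carrier_vec ?d \<and> z \<noteq> 0\<^sub>v ?d \<and> x *\<^sub>v z = ?ev r \<cdot>\<^sub>v z \<and>
      (\<forall>i<k. z \<bullet>c v i = 0 \<and> z \<bullet>c quat n (v i) = 0)"
  proof (cases "r \<le> m div 2")
    case False
    \<comment> \<open>An angle beyond \<open>m div 2\<close> is reflected to \<open>m - r\<close> by
      passing to \<open>quat n z\<close>, which is nonzero and still orthogonal to the earlier
      pairs.\<close>
    let ?q = "quat n z"
    have "?ev (m - r) = cis (2 * pi - 2 * pi * (real r / real m))"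
      using r by (simp add: of_nat_diff field_simps)
    also have "\<dots> = cnj (?ev r)"
      by (simp add: complex_eq_iff)
    finally have "x *\<^sub>v ?q = ?ev (m - r) \<cdot>\<^sub>v ?q"
      using z by (simp add: compact_Sp_quat_commute[OF x] quat_smult)
    moreover have "?q \<noteq> 0\<^sub>v ?d"
      using cscalar_quat_quat[OF z(1) z(1)] z conjugate_square_eq_0_vec[OF z(1)] by auto
    moreover have "?q \<bullet>c v i = 0 \<and> ?q \<bullet>c quat n (v i) = 0" if "i < k" for i
      using zv[OF that] cscalar_quat_quat[OF z(1) vc[OF that]] cscalar_quat_right[OF z(1) vc[OF that]]
        cscalar_swap[OF vc[OF that] quat_carrier, of z] by simp
    moreover have "m - r \<le> m div 2" using False by linarith
    ultimately show ?thesis by (metis quat_carrier)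
  qed (use z zv in blast)
  then obtain r z where r: "r \<le> m div 2" and z: "z \<in> carrier_vec ?d" "z \<noteq> 0\<^sub>v ?d" "x *\<^sub>v z = ?ev r \<cdot>\<^sub>v z"
    and zv: "\<And>i. i < k \<Longrightarrow> z \<bullet>c v i = 0" "\<And>i. i < k \<Longrightarrow> z \<bullet>c quat n (v i) = 0" by blast
  define N where "N = sqrt (Re (z \<bullet>c z))"
  have zz: "z \<bullet>c z > 0" using z by simp
  hence "N > 0" "z \<bullet>c z = of_real (N\<^sup>2)"
    by (auto simp: N_def less_complex_def complex_eq_iff)
  define y where "y = of_real (1 / N) \<cdot>\<^sub>v z"
  have y: "y \<in> carrier_vec ?d" using z by (simp add: y_def)
  have yy: "y \<bullet>c y = 1"
    using \<open>N > 0\<close> \<open>z \<bullet>c z = of_real (N\<^sup>2)\<close> z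
    by (simp add: y_def conjugate_smult_vec power2_eq_square)
  have yv: "y \<bullet>c v i = 0" "y \<bullet>c quat n (v i) = 0" "v i \<bullet>c y = 0" "v i \<bullet>c quat n y = 0" if "i < k" for i
  proof -
    show 1: "y \<bullet>c v i = 0" "y \<bullet>c quat n (v i) = 0"
      using zv[OF that] z vc[OF that] by (simp_all add: y_def)
    show "v i \<bullet>c y = 0" using 1 cscalar_swap[OF y vc[OF that]] by simp
    show "v i \<bullet>c quat n y = 0" using 1 cscalar_quat_right[OF y vc[OF that]] by simp
  qed
  have xy: "x *\<^sub>v y = ?ev r \<cdot>\<^sub>v y"
    using z xc by (simp add: y_def mult_mat_vec smult_smult_assoc mult.commute)
  have "quat_orthonormal n (Suc k) (v(k := y))"
    using v y yy yv cscalar_quat_self[OF y] by (auto simp: quat_orthonormal_def less_Suc_eq)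
  moreover have "\<forall>i<Suc k. (t(k := r)) i \<le> m div 2 \<and>
      x *\<^sub>v (v(k := y)) i = ?ev ((t(k := r)) i) \<cdot>\<^sub>v (v(k := y)) i"
    using t eig r xy by (auto simp: less_Suc_eq)
  ultimately show ?case by blast
qed

subsection \<open>Conjugacy classes\<close>

lemma proots_prod_linear_factors:
  fixes as :: "'a :: idom list"
  shows "proots (\<Prod>a\<leftarrow>as. [:- a, 1:]) = mset as"
proof (induction as)
  case (Cons a as)
  have "(\<Prod>a\<leftarrow>as. [:- a, 1:]) \<noteq> 0" by (auto simp: prod_list_zero_iff)
  thus ?case using Cons by (simp add: proots_mult del: mult_pCons_left)
qed simp

text \<open>Unlike \<open>spectrum_torus_elt\<close> this keeps multiplicities, on which the
  multiset of angles depends.\<close>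

lemma proots_char_poly_torus_elt:
  "proots (char_poly (torus_elt n \<theta>)) =
     {#cis (2 * pi * \<theta> l). l \<in># mset [0..<n]#} + {#cis (- (2 * pi * \<theta> l)). l \<in># mset [0..<n]#}"
proof -
  let ?f = "\<lambda>i. if i < n then cis (2 * pi * \<theta> i) else cis (- (2 * pi * \<theta> (i - n)))"
  have "upper_triangular (torus_elt n \<theta>)" by (auto simp: torus_elt_def mat_diag_def)
  hence "proots (char_poly (torus_elt n \<theta>)) = mset (diag_mat (torus_elt n \<theta>))"
    using char_poly_upper_triangular[OF torus_elt_carrier] proots_prod_linear_factors by metis
  also have "diag_mat (torus_elt n \<theta>) = map ?f [0..<2 * n]"
    by (auto simp: diag_mat_def torus_elt_def mat_diag_def)
  also have "[0..<2 * n] = [0..<n] @ map (\<lambda>i. i + n) [0..<n]"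
    using upt_add_eq_append[of 0 n n] by (simp add: mult_2 map_add_upt)
  also have "map ?f \<dots> = map (\<lambda>l. cis (2 * pi * \<theta> l)) [0..<n] @ map (\<lambda>l. cis (- (2 * pi * \<theta> l))) [0..<n]"
    by simp
  finally show ?thesis by (simp only: mset_append mset_map)
qed

text \<open>Taking real parts folds each conjugate pair of eigenvalues to two copies of one cosine,
  so the eigenvalues determine the multiset of cosines, hence that of angles in \<open>[0,1/2]\<close>.\<close>

lemma torus_elt_angles_unique:
  assumes eq: "char_poly (torus_elt n \<theta>) = char_poly (torus_elt n \<eta>)"
    and r: "\<And>l. l < n \<Longrightarrow> \<theta> l \<in> {0..1/2}" "\<And>l. l < n \<Longrightarrow> \<eta> l \<in> {0..1/2}"
  shows "image_mset \<theta> (mset [0..<n]) = image_mset \<eta> (mset [0..<n])"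
proof -
  let ?I = "mset [0..<n]" and ?c = "\<lambda>t. cos (2 * pi * t)"
  have re: "image_mset Re (proots (char_poly (torus_elt n f))) =
      repeat_mset 2 (image_mset ?c (image_mset f ?I))" for f
    unfolding proots_char_poly_torus_elt
    by (simp add: multiset.map_comp comp_def multiset_eq_iff)
  have "repeat_mset 2 (image_mset ?c (image_mset \<theta> ?I)) = repeat_mset 2 (image_mset ?c (image_mset \<eta> ?I))"
    using re[of \<theta>] re[of \<eta>] eq by simp
  hence c: "image_mset ?c (image_mset \<theta> ?I) = image_mset ?c (image_mset \<eta> ?I)"
    by (simp add: multiset_eq_iff)
  \<comment> \<open>For such \<open>t\<close> the argument \<open>2 * pi * t\<close> lies in the
    interval from 0 to \<open>pi\<close>, where \<open>arccos\<close> inverts the cosine.\<close>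
  have "arccos (?c t) / (2 * pi) = t" if "t \<in> {0..1/2}" for t
    using that mult_left_mono[of t "1/2" "2 * pi"] by (subst arccos_cos) auto
  hence recover: "image_mset (\<lambda>y. arccos y / (2 * pi)) (image_mset ?c (image_mset f ?I)) = image_mset f ?I"
    if "\<And>l. l < n \<Longrightarrow> f l \<in> {0..1/2}" for f
    unfolding multiset.map_comp comp_def using that by (intro image_mset_cong) auto
  show ?thesis using recover[of \<theta>] recover[of \<eta>] r c by metis
qed

text \<open>An element \<open>k\<close> of \<open>M\<close> stands for the angle
  \<open>k / m\<close>. Sorting chooses one representative among the orderings of \<open>M\<close>,
  all of which give conjugate torus elements.\<close>

definition torus_of_mset :: "nat \<Rightarrow> nat \<Rightarrow> nat multiset \<Rightarrow> complex mat" where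
  "torus_of_mset n m M = torus_elt n (\<lambda>l. real (sorted_list_of_multiset M ! l) / real m)"

lemma torus_of_mset_angles:
  assumes "size M = n"
  shows "{#real (sorted_list_of_multiset M ! l) / real m. l \<in># mset [0..<n]#} = {#real k / real m. k \<in># M#}"
proof -
  let ?xs = "sorted_list_of_multiset M"
  have "length ?xs = n" using assms by (metis mset_sorted_list_of_multiset size_mset)
  hence "map (\<lambda>l. ?xs ! l) [0..<n] = ?xs" by (metis map_nth)
  hence "{#?xs ! l. l \<in># mset [0..<n]#} = M" by (metis mset_map mset_sorted_list_of_multiset)
  thus ?thesis using multiset.map_comp[of "\<lambda>k. real k / real m" "\<lambda>l. ?xs ! l" "mset [0..<n]"]
    by (simp add: comp_def)
qed

lemma torus_of_mset_angle_range:
  assumes "M \<in> multisets_of_size {..m div 2} n" "m > 0" "l < n"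
  shows "real (sorted_list_of_multiset M ! l) / real m \<in> {0..1/2}"
proof -
  let ?xs = "sorted_list_of_multiset M"
  have M: "set_mset M \<subseteq> {..m div 2}" "size M = n"
    using assms(1) by (auto simp: multisets_of_size_def)
  have "length ?xs = n" using M by (metis mset_sorted_list_of_multiset size_mset)
  hence "?xs ! l \<in> set_mset M" using assms(3) by (metis nth_mem set_sorted_list_of_multiset)
  hence "2 * (?xs ! l) \<le> m" using M by fastforce
  hence "2 * real (?xs ! l) \<le> real m" by linarith
  thus ?thesis using assms(2) by (simp add: field_simps)
qed

lemma mat_diag_pow: "mat_diag n f ^\<^sub>m k = mat_diag n (\<lambda>i. f i ^ k :: 'a :: comm_ring_1)"
  by (induction k) (auto simp: mult.commute carrier_matD(1)[OF mat_diag_dim])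

lemma torus_of_mset_pow:
  assumes "m > 0"
  shows "torus_of_mset n m M ^\<^sub>m m = 1\<^sub>m (2 * n)"
proof -
  have "cis (2 * pi * (real k / real m)) ^ m = 1" "cis (- (2 * pi * (real k / real m))) ^ m = 1" for k
    using assms cis_multiple_2pi[of "real k"] cis_multiple_2pi[of "- real k"]
    by (simp_all add: DeMoivre)
  thus ?thesis unfolding torus_of_mset_def torus_elt_def mat_diag_pow
    by (auto simp: mat_diag_def intro!: eq_matI)
qed

lemma compact_Sp_conj_torus_of_mset:
  assumes x: "x \<in> carrier (compact_Sp n)" and ord: "x ^\<^sub>m m = 1\<^sub>m (2 * n)" and "m > 0"
  obtains M g where "M \<in> multisets_of_size {..m div 2} n" "g \<in> carrier (compact_Sp n)"
    "x = g \<otimes>\<^bsub>compact_Sp n\<^esub> torus_of_mset n m M \<otimes>\<^bsub>compact_Sp n\<^esub> inv\<^bsub>compact_Sp n\<^esub> g"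
proof -
  obtain v t where v: "quat_orthonormal n n v" and t: "\<And>i. i < n \<Longrightarrow> t i \<le> m div 2"
    and eig: "\<And>i. i < n \<Longrightarrow> x *\<^sub>v v i = cis (2 * pi * (real (t i) / real m)) \<cdot>\<^sub>v v i"
    using exists_quat_eigenframe[OF x ord \<open>m > 0\<close> order.refl] by blast
  define M where "M = mset (map t [0..<n])"
  \<comment> \<open>The frame lists its angles in the order of construction; \<open>p\<close>
    rearranges them, and the frame with them, into the sorted order of
    \<open>torus_of_mset\<close>.\<close>
  have "mset (sorted_list_of_multiset M) = mset (map t [0..<n])" by (simp add: M_def)
  then obtain p where p: "p permutes {..<length (map t [0..<n])}"
    and pl: "permute_list p (map t [0..<n]) = sorted_list_of_multiset M"
    by (rule mset_eq_permutation)
  have pn: "p permutes {..<n}" using p by simp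
  have pi: "p i < n" if "i < n" for i using that permutes_in_image[OF pn, of i] by simp
  have nth: "sorted_list_of_multiset M ! i = t (p i)" if "i < n" for i
    using permute_list_nth[OF p, of i] pl that pi[OF that] by simp
  have inj: "p i = p l \<longleftrightarrow> i = l" for i l using permutes_inj[OF pn] by (auto dest: injD)
  have "quat_orthonormal n n (v \<circ> p)" using v pi by (auto simp: quat_orthonormal_def inj)
  hence "\<exists>g\<in>carrier (compact_Sp n). x = g \<otimes>\<^bsub>compact_Sp n\<^esub> torus_of_mset n m M \<otimes>\<^bsub>compact_Sp n\<^esub> inv\<^bsub>compact_Sp n\<^esub> g"
    unfolding torus_of_mset_def using eig pi
    by (intro conj_torus_of_eigenframe[OF x]) (auto simp: nth)
  moreover have "M \<in> multisets_of_size {..m div 2} n"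
    using t by (auto simp: M_def multisets_of_size_def)
  ultimately show ?thesis using that by blast
qed

text \<open>Supplies the class invariant that separates the torus representatives.\<close>

lemma char_poly_compact_Sp_conj:
  assumes "g \<in> carrier (compact_Sp n)" "x \<in> carrier (compact_Sp n)"
  shows "char_poly (g \<otimes>\<^bsub>compact_Sp n\<^esub> x \<otimes>\<^bsub>compact_Sp n\<^esub> inv\<^bsub>compact_Sp n\<^esub> g) = char_poly x"
proof -
  interpret group "compact_Sp n" by (rule group_compact_Sp)
  let ?h = "inv\<^bsub>compact_Sp n\<^esub> g" and ?d = "2 * n"
  have c: "g \<in> carrier_mat ?d ?d" "x \<in> carrier_mat ?d ?d" "?h \<in> carrier_mat ?d ?d"
    using assms inv_closed[OF assms(1)] by (auto simp: compact_Sp_def unitary_mats_def)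
  moreover have "g * ?h = 1\<^sub>m ?d" "?h * g = 1\<^sub>m ?d"
    using r_inv[OF assms(1)] l_inv[OF assms(1)] by (simp_all add: compact_Sp_def)
  ultimately have "similar_mat (g * x * ?h) x" by (intro similar_matI[of _ _ g ?h ?d]) auto
  thus ?thesis using char_poly_similar by (simp add: compact_Sp_def)
qed

text \<open>Surjectivity is diagonalization, injectivity is recovery of the angles from the
  characteristic polynomial, and the distinct elements of \<open>M\<close> are the distinct angles,
  hence the conjugate pairs.\<close>

lemma bij_betw_mset_Sp_classes:
  fixes n m s :: nat
  assumes "m > 0"
  defines "conj_class \<equiv> orbit (compact_Sp n)
    (\<lambda>g. \<lambda>h \<in> carrier (compact_Sp n). g \<otimes>\<^bsub>compact_Sp n\<^esub> h \<otimes>\<^bsub>compact_Sp n\<^esub> inv\<^bsub>compact_Sp n\<^esub> g)"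
  shows "bij_betw (\<lambda>M. conj_class (torus_of_mset n m M))
    {M \<in> multisets_of_size {..m div 2} n. card (set_mset M) = s} (Sp_classes n m s)"
proof -
  let ?G = "compact_Sp n"
  interpret G: group ?G by (rule group_compact_Sp)
  interpret act: group_action ?G "carrier ?G"
    "\<lambda>g. \<lambda>h \<in> carrier ?G. g \<otimes>\<^bsub>?G\<^esub> h \<otimes>\<^bsub>?G\<^esub> inv\<^bsub>?G\<^esub> g"
    by (rule G.action_by_conjugation)
  have mem: "y \<in> conj_class x \<longleftrightarrow> (\<exists>g\<in>carrier ?G. y = g \<otimes>\<^bsub>?G\<^esub> x \<otimes>\<^bsub>?G\<^esub> inv\<^bsub>?G\<^esub> g)"
    if "x \<in> carrier ?G" for x y
    using that by (auto simp: conj_class_def orbit_def)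
  have T: "torus_of_mset n m M \<in> carrier ?G" for M
    by (simp add: torus_of_mset_def torus_elt_in_compact_Sp)
  have classes: "conjugacy_classes ?G = conj_class ` carrier ?G"
    by (auto simp: conjugacy_classes_def orbits_def conj_class_def)
  have refl: "x \<in> conj_class x" if "x \<in> carrier ?G" for x
    unfolding conj_class_def by (rule act.orbit_refl[OF that])
  \<comment> \<open>Orbits are disjoint or equal, and these two share \<open>y\<close>.\<close>
  have class_eq: "conj_class y = conj_class x" if x: "x \<in> carrier ?G" and y: "y \<in> conj_class x" for x y
  proof -
    have "y \<in> carrier ?G" using y mem[OF x] x by auto
    hence "conj_class x \<in> orbits ?G (carrier ?G) (\<lambda>g. \<lambda>h \<in> carrier ?G. g \<otimes>\<^bsub>?G\<^esub> h \<otimes>\<^bsub>?G\<^esub> inv\<^bsub>?G\<^esub> g)"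
      "conj_class y \<in> orbits ?G (carrier ?G) (\<lambda>g. \<lambda>h \<in> carrier ?G. g \<otimes>\<^bsub>?G\<^esub> h \<otimes>\<^bsub>?G\<^esub> inv\<^bsub>?G\<^esub> g)"
      using x by (auto simp: orbits_def conj_class_def)
    thus ?thesis using act.disjoint_union y refl[OF \<open>y \<in> carrier ?G\<close>] by blast
  qed
  have pairs: "num_conjugate_pairs y = card (set_mset M)"
    if M: "M \<in> multisets_of_size {..m div 2} n" and y: "y \<in> conj_class (torus_of_mset n m M)" for M y
  proof -
    let ?\<theta> = "\<lambda>l. real (sorted_list_of_multiset M ! l) / real m"
    obtain g where "g \<in> carrier ?G" "y = g \<otimes>\<^bsub>?G\<^esub> torus_elt n ?\<theta> \<otimes>\<^bsub>?G\<^esub> inv\<^bsub>?G\<^esub> g"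
      using y mem[OF T] by (auto simp: torus_of_mset_def)
    hence "num_conjugate_pairs y = card (?\<theta> ` {..<n})"
      using torus_of_mset_angle_range[OF M assms(1)] by (intro num_conjugate_pairs_conj_torus) auto
    also have "?\<theta> ` {..<n} = set_mset (image_mset ?\<theta> (mset [0..<n]))" by auto
    also have "\<dots> = (\<lambda>k. real k / real m) ` set_mset M"
      using M by (subst torus_of_mset_angles) (auto simp: multisets_of_size_def)
    also have "card \<dots> = card (set_mset M)"
      using assms(1) by (intro card_image) (auto simp: inj_on_def)
    finally show ?thesis .
  qed
  have pow: "y [^]\<^bsub>?G\<^esub> m = \<one>\<^bsub>?G\<^esub>" if y: "y \<in> conj_class (torus_of_mset n m M)" for M y
  proof -
    let ?T = "torus_of_mset n m M"
    obtain g where g: "g \<in> carrier ?G" "y = g \<otimes>\<^bsub>?G\<^esub> ?T \<otimes>\<^bsub>?G\<^esub> inv\<^bsub>?G\<^esub> g"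
      using y mem[OF T] by auto
    \<comment> \<open>Powers of a conjugate are conjugates of powers, so the order condition passes
      from the torus element to its whole class.\<close>
    have "y [^]\<^bsub>?G\<^esub> k = g \<otimes>\<^bsub>?G\<^esub> (?T [^]\<^bsub>?G\<^esub> k) \<otimes>\<^bsub>?G\<^esub> inv\<^bsub>?G\<^esub> g" for k :: nat
    proof (induction k)
      case (Suc k)
      have "inv\<^bsub>?G\<^esub> g \<otimes>\<^bsub>?G\<^esub> (g \<otimes>\<^bsub>?G\<^esub> z) = z" if "z \<in> carrier ?G" for z
        using g(1) that by (simp add: G.m_assoc[symmetric])
      thus ?case using g T[of M] Suc by (simp add: G.m_assoc)
    qed (use g in simp)
    moreover have "?T [^]\<^bsub>?G\<^esub> m = \<one>\<^bsub>?G\<^esub>"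
      using compact_Sp_nat_pow[OF T] torus_of_mset_pow[OF assms(1)] by (simp add: compact_Sp_def)
    ultimately show ?thesis using g by simp
  qed
  show ?thesis
  proof (rule bij_betw_imageI)
    show "inj_on (\<lambda>M. conj_class (torus_of_mset n m M))
        {M \<in> multisets_of_size {..m div 2} n. card (set_mset M) = s}"
    proof (rule inj_onI, clarify)
      fix M M' assume M: "M \<in> multisets_of_size {..m div 2} n" and M': "M' \<in> multisets_of_size {..m div 2} n"
        and eq: "conj_class (torus_of_mset n m M) = conj_class (torus_of_mset n m M')"
      have "torus_of_mset n m M \<in> conj_class (torus_of_mset n m M')"
        using refl[OF T] eq by blast
      hence "char_poly (torus_of_mset n m M) = char_poly (torus_of_mset n m M')"
        using mem[OF T] char_poly_compact_Sp_conj[OF _ T] by metis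
      hence "{#real k / real m. k \<in># M#} = {#real k / real m. k \<in># M'#}"
        unfolding torus_of_mset_def
        using M M' torus_of_mset_angle_range[OF M assms(1)] torus_of_mset_angle_range[OF M' assms(1)]
        by (subst (1 2) torus_of_mset_angles[of _ n, symmetric])
          (auto simp only: multisets_of_size_def mem_Collect_eq intro!: torus_elt_angles_unique)
      moreover have "inj (\<lambda>k. real k / real m)" using assms(1) by (auto simp: inj_def)
      ultimately show "M = M'" by (meson injD multiset.inj_map)
    qed
    show "(\<lambda>M. conj_class (torus_of_mset n m M)) `
        {M \<in> multisets_of_size {..m div 2} n. card (set_mset M) = s} = Sp_classes n m s"
    proof (intro equalityI subsetI)
      fix C assume "C \<in> (\<lambda>M. conj_class (torus_of_mset n m M)) `
        {M \<in> multisets_of_size {..m div 2} n. card (set_mset M) = s}"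
      then obtain M where M: "M \<in> multisets_of_size {..m div 2} n" "card (set_mset M) = s"
        and C: "C = conj_class (torus_of_mset n m M)" by blast
      have "C \<in> conjugacy_classes ?G" unfolding classes C by (rule imageI[OF T])
      moreover have "x [^]\<^bsub>?G\<^esub> m = \<one>\<^bsub>?G\<^esub> \<and> num_conjugate_pairs x = s" if "x \<in> C" for x
        using that pow pairs[OF M(1)] M(2) unfolding C by blast
      ultimately show "C \<in> Sp_classes n m s" by (simp add: Sp_classes_def)
    next
      fix C assume C: "C \<in> Sp_classes n m s"
      then obtain x where x: "x \<in> carrier ?G" "C = conj_class x"
        unfolding Sp_classes_def classes by blast
      \<comment> \<open>The conditions in \<open>Sp_classes\<close> hold for every member of the
        class, in particular for \<open>x\<close>.\<close>
      have "x [^]\<^bsub>?G\<^esub> m = \<one>\<^bsub>?G\<^esub>" and s: "num_conjugate_pairs x = s"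
        using C refl[OF x(1)] unfolding Sp_classes_def x(2) by blast+
      hence "x ^\<^sub>m m = 1\<^sub>m (2 * n)" using compact_Sp_nat_pow[OF x(1)] by (simp add: compact_Sp_def)
      then obtain M g where M: "M \<in> multisets_of_size {..m div 2} n" and g: "g \<in> carrier ?G"
        "x = g \<otimes>\<^bsub>?G\<^esub> torus_of_mset n m M \<otimes>\<^bsub>?G\<^esub> inv\<^bsub>?G\<^esub> g"
        using compact_Sp_conj_torus_of_mset[OF x(1) _ assms(1)] by metis
      have xT: "x \<in> conj_class (torus_of_mset n m M)" using g mem[OF T] by blast
      show "C \<in> (\<lambda>M. conj_class (torus_of_mset n m M)) `
          {M \<in> multisets_of_size {..m div 2} n. card (set_mset M) = s}"
        using M s pairs[OF M xT] class_eq[OF T xT] x(2)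
        by (intro image_eqI[of _ _ M]) simp_all
    qed
  qed
qed

theorem theorem8:
  fixes n m s :: nat
  assumes "n > 0" and "m > 0" and "s > 0"
  shows "finite (Sp_classes n m s) \<and>
    N_Sp n m s = ((n - 1) choose (s - 1)) * ((nat \<lfloor>real m / 2\<rfloor> + 1) choose s)"
proof -
  \<comment> \<open>The possible numerators are \<open>0\<close> to \<open>m div 2\<close>, both
    ends included, which gives the \<open>+ 1\<close>.\<close>
  let ?K = "{..m div 2}"
  note bij = bij_betw_mset_Sp_classes[OF \<open>m > 0\<close>, of n s]
  \<comment> \<open>Finiteness passes along the bijection, so the cardinality in \<open>N_Sp\<close>
    is a genuine count and not the default 0 of an infinite set.\<close>
  have "finite {M \<in> multisets_of_size ?K n. card (set_mset M) = s}"
    by (simp add: finite_multisets_of_size)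
  moreover have "nat \<lfloor>real m / 2\<rfloor> = m div 2"
    using floor_divide_of_nat_eq[of m 2, where ?'a = real] by simp
  ultimately show ?thesis
    using bij_betw_finite[OF bij] bij_betw_same_card[OF bij]
      card_multisets_support_size[OF _ assms(1,3), of ?K]
    by (simp add: N_Sp_def)
qed

end
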